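(* Let $G$ be a finite group and $\pi$ a set of primes. For $q\in\pi$, let $\mathcal{S}_q(G_\pi)$ denote the union of all conjugacy classes $g^G$ with $g$ a $\pi$-element of $G$ such that $|g^G|$ is a power of $q$ (including $q^0=1$). Then for every $q\in\pi$, $$|\mathcal{S}_q(G_\pi)|_q=|\mathbf{Z}_\infty(G)|_q.$$ In particular, for $q\in\pi$, a Sylow $q$-subgroup of $G$ is hypercentral (i.e. contained in $\mathbf{Z}_\infty(G)$) if and only if $|G|_q=|\mathcal{S}_q(G_\pi)|_q$.
   Context: A $\pi$-element is an element whose order is divisible only by primes in $\pi$. For a positive integer $n$ and prime $q$, $n_q$ denotes the largest power of $q$ dividing $n$. $|g^G|=|G:C_G(g)|$. The hypercentre $\mathbf{Z}_\infty(G)$ is the last term of the upper central series $1\le\mathbf{Z}_1(G)\le\mathbf{Z}_2(G)\le\cdots$, with $\mathbf{Z}_1(G)=\mathbf{Z}(G)$ and $\mathbf{Z}_{i+1}(G)/\mathbf{Z}_i(G)=\mathbf{Z}(G/\mathbf{Z}_i(G))$. *)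

theory Defs
  imports "HOL-Algebra.Algebra" "HOL-Computational_Algebra.Primes"
begin

definition grp_center :: "('a, 'b) monoid_scheme \<Rightarrow> 'a set" where
  "grp_center G = {z \<in> carrier G. \<forall>y \<in> carrier G. z \<otimes>\<^bsub>G\<^esub> y = y \<otimes>\<^bsub>G\<^esub> z}"

fun upper_central :: "('a, 'b) monoid_scheme \<Rightarrow> nat \<Rightarrow> 'a set" where
  "upper_central G 0 = {\<one>\<^bsub>G\<^esub>}"
| "upper_central G (Suc i) =
     {x \<in> carrier G. upper_central G i #>\<^bsub>G\<^esub> x \<in> grp_center (G Mod (upper_central G i))}"

definition hypercentre :: "('a, 'b) monoid_scheme \<Rightarrow> 'a set" where
  "hypercentre G = (\<Union>i. upper_central G i)"

definition ppart :: "nat \<Rightarrow> nat \<Rightarrow> nat" where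
  "ppart q n = q ^ multiplicity q n"

definition pi_elem :: "('a, 'b) monoid_scheme \<Rightarrow> nat set \<Rightarrow> 'a \<Rightarrow> bool" where
  "pi_elem G \<pi> g \<longleftrightarrow> g \<in> carrier G \<and>
     (\<forall>p. Factorial_Ring.prime p \<and> p dvd group.ord G g \<longrightarrow> p \<in> \<pi>)"

definition conj_class :: "('a, 'b) monoid_scheme \<Rightarrow> 'a \<Rightarrow> 'a set" where
  "conj_class G g = {h \<otimes>\<^bsub>G\<^esub> g \<otimes>\<^bsub>G\<^esub> inv\<^bsub>G\<^esub> h | h. h \<in> carrier G}"

definition S_q :: "('a, 'b) monoid_scheme \<Rightarrow> nat set \<Rightarrow> nat \<Rightarrow> 'a set" where
  "S_q G \<pi> q = \<Union> {conj_class G g | g. pi_elem G \<pi> g \<and> (\<exists>k. card (conj_class G g) = q ^ k)}"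

definition sylow_subgroup :: "('a, 'b) monoid_scheme \<Rightarrow> nat \<Rightarrow> 'a set \<Rightarrow> bool" where
  "sylow_subgroup G q P \<longleftrightarrow> subgroup P G \<and> card P = ppart q (order G)"

end

theory Submission
  imports Defs
begin

text \<open>
  Let \<open>N\<close> be a Sylow \<open>q\<close>-subgroup of the hypercentre. Elements of \<open>G\<close> of order prime to \<open>q\<close>
  centralise hypercentral \<open>q\<close>-elements; hence \<open>N\<close> is normal in \<open>G\<close> and consists of all hypercentral
  \<open>q\<close>-elements. If \<open>D\<close> is the preimage of the centraliser of \<open>Ng\<close> in \<open>G/N\<close>, then an element of \<open>D\<close> of
  order prime to \<open>q\<close> already commutes with \<open>g\<close>, so the index of \<open>C(g)\<close> in \<open>D\<close> is a power of \<open>q\<close>.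
  Therefore the class size of \<open>g\<close> is a power of \<open>q\<close> iff that of \<open>Ng\<close> is, and the set \<open>S_q\<close> of \<open>G\<close> is
  the full preimage of the set \<open>S_q\<close> of \<open>G/N\<close>. The latter is a union of classes whose sizes are
  powers of \<open>q\<close>, so modulo \<open>q\<close> its cardinality is the number of central \<open>\<pi>\<close>-elements of \<open>G/N\<close>,
  which divides \<open>|Z(G/N)|\<close>. By maximality of \<open>N\<close> this centre has no element of order \<open>q\<close>.
\<close>

section \<open>Commutators and elements of coprime order\<close>

text \<open>Here \<open>n\<close> is the commutator of \<open>h\<close> and \<open>x\<close>; an
  equation without inverses passes easily through homomorphisms. Each \<open>h\<close> moved past
  \<open>x\<close> leaves one \<open>n\<close> behind, and these copies collect because
  \<open>h\<close> commutes with \<open>n\<close>.\<close>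

lemma (in group) twisted_pow_left:
  fixes k :: nat
  assumes "h \<in> carrier G" "x \<in> carrier G" "n \<in> carrier G"
    and "h \<otimes> x = n \<otimes> x \<otimes> h" and "h \<otimes> n = n \<otimes> h"
  shows "h [^] k \<otimes> x = n [^] k \<otimes> x \<otimes> h [^] k"
proof (induction k)
  case 0
  then show ?case using assms by simp
next
  case (Suc k)
  have c: "h [^] k \<otimes> n = n \<otimes> h [^] k"
    using assms by (metis group_commutes_pow)
  have "h [^] Suc k \<otimes> x = h [^] k \<otimes> (n \<otimes> x \<otimes> h)"
    using assms by (simp add: m_assoc)
  also have "\<dots> = (h [^] k \<otimes> n) \<otimes> x \<otimes> h"
    using assms(1-3) by (simp add: m_assoc)
  also have "\<dots> = n \<otimes> (h [^] k \<otimes> x) \<otimes> h"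
    using assms(1-3) c by (simp add: m_assoc)
  also have "\<dots> = (n \<otimes> n [^] k) \<otimes> x \<otimes> (h [^] k \<otimes> h)"
    using assms(1-3) Suc by (simp add: m_assoc)
  finally show ?case
    using assms(3) by (metis nat_pow_Suc nat_pow_Suc2)
qed

lemma (in group) twisted_pow_right:
  fixes k :: nat
  assumes "h \<in> carrier G" "x \<in> carrier G" "n \<in> carrier G"
    and "h \<otimes> x = n \<otimes> x \<otimes> h" and "x \<otimes> n = n \<otimes> x"
  shows "h \<otimes> x [^] k = n [^] k \<otimes> x [^] k \<otimes> h"
proof (induction k)
  case 0
  then show ?case using assms by simp
next
  case (Suc k)
  have c: "x [^] k \<otimes> n = n \<otimes> x [^] k"
    using assms by (metis group_commutes_pow)
  have "h \<otimes> x [^] Suc k = (h \<otimes> x [^] k) \<otimes> x"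
    using assms(1-3) by (simp add: m_assoc)
  also have "\<dots> = n [^] k \<otimes> x [^] k \<otimes> (h \<otimes> x)"
    using assms(1-3) Suc by (simp add: m_assoc)
  also have "\<dots> = n [^] k \<otimes> (x [^] k \<otimes> n) \<otimes> x \<otimes> h"
    using assms by (simp add: m_assoc)
  also have "\<dots> = (n [^] k \<otimes> n) \<otimes> (x [^] k \<otimes> x) \<otimes> h"
    using assms(1-3) c by (simp add: m_assoc)
  finally show ?case
    using assms(1-3) by simp
qed

lemma (in group) coprime_pow_eq_one:
  fixes a b :: nat
  assumes "x \<in> carrier G" "x [^] a = \<one>" "x [^] b = \<one>" "coprime a b"
  shows "x = \<one>"
  using assms by (metis coprime_common_divisor_nat ord_eq_1 pow_eq_id)

text \<open>Collecting \<open>a\<close> copies of the commutator shows that \<open>n [^] a\<close>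
  is trivial, so both coprime exponents kill \<open>n\<close>. In the application \<open>n\<close>
  lies in a kernel consisting of \<open>q\<close>-elements, and \<open>b\<close> is a power of
  \<open>q\<close>.\<close>

lemma (in group) twisted_pow_left_coprime:
  fixes a b :: nat
  assumes "h \<in> carrier G" "x \<in> carrier G" "n \<in> carrier G"
    and "h \<otimes> x = n \<otimes> x \<otimes> h" and "h \<otimes> n = n \<otimes> h"
    and "h [^] a = \<one>" "n [^] b = \<one>" "coprime a b"
  shows "h \<otimes> x = x \<otimes> h"
proof -
  have "n [^] a = \<one>"
    using twisted_pow_left[of h x n a] assms by simp
  then show ?thesis
    using coprime_pow_eq_one[of n a b] assms by simp
qed

text \<open>A central commutator can be collected from powers of either factor, so it inherits the
  exponent \<open>a\<close> from \<open>h\<close> and the exponent \<open>b\<close> from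
  \<open>x\<close>.\<close>

lemma (in group) twisted_central_coprime:
  fixes a b :: nat
  assumes "h \<in> carrier G" "x \<in> carrier G" "n \<in> grp_center G"
    and "h \<otimes> x = n \<otimes> x \<otimes> h"
    and "h [^] a = \<one>" "x [^] b = \<one>" "coprime a b"
  shows "n = \<one>"
proof -
  have n: "n \<in> carrier G" "h \<otimes> n = n \<otimes> h" "x \<otimes> n = n \<otimes> x"
    using assms by (auto simp: grp_center_def)
  have "n [^] a = \<one>"
    using twisted_pow_left[of h x n a] assms n by simp
  moreover have "n [^] b = \<one>"
    using twisted_pow_right[of h x n b] assms n by simp
  ultimately show ?thesis
    using coprime_pow_eq_one[of n a b] n assms by simp
qed

section \<open>Lagrange, Cauchy and Sylow arguments\<close>

lemma (in group) card_subgroup_dvd: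
  assumes "subgroup A G" "subgroup B G" "A \<subseteq> B"
  shows "card A dvd card B"
  using group.lagrange[OF subgroup_imp_group[OF assms(2)] subgroup_incl[OF assms]]
  by (simp add: order_def) (metis dvd_triv_right)

lemma (in group) subgroup_pow_card:
  assumes "subgroup A G" "x \<in> A"
  shows "x [^] card A = \<one>"
  using group.pow_order_eq_1[OF subgroup_imp_group[OF assms(1)], of x] assms(2)
    nat_pow_consistent[of x "card A" A] by (simp add: order_def)

text \<open>\<open>sylow_thm\<close> accepts any factorisation \<open>q ^ a * m\<close> of the
  order; with exponent 1 it yields a subgroup of order \<open>q\<close>, and any of its nontrivial
  elements will do.\<close>

lemma (in group) cauchy_subgroup:
  assumes "finite (carrier G)" "subgroup A G" "Factorial_Ring.prime q" "q dvd card A"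
  obtains x where "x \<in> A" "x \<noteq> \<one>" "x [^] q = \<one>"
proof -
  interpret A: group "G\<lparr>carrier := A\<rparr>" by (rule subgroup_imp_group[OF assms(2)])
  obtain m where "order (G\<lparr>carrier := A\<rparr>) = q ^ 1 * m"
    using assms(4) by (auto simp: order_def)
  then obtain B where B: "subgroup B (G\<lparr>carrier := A\<rparr>)" "card B = q"
    using sylow_thm[OF assms(3) A.is_group, of 1 m] assms(1) subgroup.finite_imp_card_positive
      finite_subset[OF subgroup.subset[OF assms(2)]] by auto
  have "card B > 1" using B prime_gt_1_nat[OF assms(3)] by simp
  then have "\<not> B \<subseteq> {\<one>}" using card_mono[of "{\<one>}" B] by auto
  then obtain x where x: "x \<in> B" "x \<noteq> \<one>" by blast
  have "x [^] q = \<one>"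
    using A.subgroup_pow_card[OF B(1) x(1)] B(2) nat_pow_consistent[of x q A] by simp
  then show thesis
    using that x subgroup.subset[OF B(1)] by auto
qed

text \<open>For a prime \<open>r\<close> other than \<open>q\<close>, a Sylow
  \<open>r\<close>-subgroup consists of elements of order prime to \<open>q\<close>, so it lies in
  \<open>H\<close>. Hence \<open>card H\<close> carries the full \<open>r\<close>-part of the group
  order and \<open>r\<close> does not divide the index.\<close>

lemma (in group) prime_power_index:
  assumes fin: "finite (carrier G)" and H: "subgroup H G" and q: "Factorial_Ring.prime (q::nat)"
    and coprime_mem: "\<And>x n. x \<in> carrier G \<Longrightarrow> x [^] (n::nat) = \<one> \<Longrightarrow> coprime n q \<Longrightarrow> x \<in> H"
  obtains k where "order G = q ^ k * card H"
proof -
  define m where "m = card (rcosets H)"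
  have ord: "order G = m * card H"
    using lagrange[OF H] by (simp add: m_def)
  have "order G > 0" using fin by (simp add: order_gt_0_iff_finite)
  then have pos: "m > 0" "card H > 0" using ord by auto
  have q_only: "r = q" if r: "Factorial_Ring.prime r" "r dvd m" for r
  proof (rule ccontr)
    assume "r \<noteq> q"
    define a where "a = multiplicity r (order G)"
    have "r ^ a dvd order G" by (simp add: a_def multiplicity_dvd)
    then obtain R where R: "subgroup R G" "card R = r ^ a"
      using sylow_thm[OF r(1) is_group _ fin] by (metis dvdE)
    have "coprime (r ^ a) q"
      using r q \<open>r \<noteq> q\<close> by (simp add: primes_coprime)
    moreover have "x [^] (r ^ a) = \<one>" if "x \<in> R" for x
      using subgroup_pow_card[OF R(1) that] R(2) by simp
    ultimately have "R \<subseteq> H"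
      using coprime_mem subgroup.subset[OF R(1)] by blast
    then have "r ^ a dvd card H"
      using card_subgroup_dvd[OF R(1) H] R(2) by simp
    then have "r ^ Suc a dvd order G"
      using mult_dvd_mono[OF r(2)] ord by simp
    moreover have "\<not> r ^ Suc a dvd order G"
      using \<open>order G > 0\<close> r(1) unfolding a_def
      by (subst power_dvd_iff_le_multiplicity) auto
    ultimately show False by blast
  qed
  obtain y where y: "m = q ^ multiplicity q m * y" "\<not> q dvd y"
    using multiplicity_decompose'[of m q] pos q not_prime_unit[of q] by blast
  have "y = 1"
  proof (rule ccontr)
    assume "y \<noteq> 1"
    then obtain r where "Factorial_Ring.prime r" "r dvd y" using prime_factor_nat by blast
    then show False using q_only y by (metis dvd_mult)
  qed
  then show thesis using y ord that[of "multiplicity q m"] by simp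
qed

text \<open>The coset of \<open>x\<close> is killed by the order \<open>a\<close> of the quotient
  and by \<open>b\<close>, hence it is trivial.\<close>

lemma (in group) coprime_quotient_mem:
  fixes a b :: nat
  assumes "N \<lhd> G" and "order G = a * card N" and "card N > 0"
    and "x \<in> carrier G" "x [^] b = \<one>" "coprime a b"
  shows "x \<in> N"
proof -
  interpret N: normal N G by fact
  interpret K: group "G Mod N" by (rule N.factorgroup_is_group)
  interpret f: group_hom G "G Mod N" "\<lambda>x. N #> x"
    by (unfold_locales) (rule N.r_coset_hom_Mod)
  have "order (G Mod N) = a"
    using lagrange[OF N.subgroup_axioms] assms(2,3) by (simp add: order_def FactGroup_def)
  then have "(N #> x) [^]\<^bsub>G Mod N\<^esub> a = \<one>\<^bsub>G Mod N\<^esub>"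
    using K.pow_order_eq_1[of "N #> x"] assms f.hom_closed by metis
  moreover have "(N #> x) [^]\<^bsub>G Mod N\<^esub> b = \<one>\<^bsub>G Mod N\<^esub>"
    using f.hom_nat_pow[of x b] assms f.hom_one by metis
  ultimately have "N #> x = N"
    using K.coprime_pow_eq_one[of "N #> x"] assms f.hom_closed by (metis one_FactGroup)
  then show ?thesis
    using rcos_self[OF assms(4) N.subgroup_axioms] by simp
qed

section \<open>Class sizes and fibres under a surjective homomorphism\<close>

text \<open>\<open>G\<close> acts on \<open>H\<close> through \<open>h\<close> by conjugation.
  Surjectivity makes the orbit of \<open>y\<close> its whole class in \<open>H\<close>, and the
  stabiliser is the preimage of its centraliser. The case of the identity map covers classes of
  \<open>G\<close> itself.\<close>

lemma (in group_hom) conj_orbit_stabilizer: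
  assumes "h ` carrier G = carrier H" "y \<in> carrier H"
  shows "card (conj_class H y) * card {g \<in> carrier G. h g \<otimes>\<^bsub>H\<^esub> y = y \<otimes>\<^bsub>H\<^esub> h g} = order G"
    and "subgroup {g \<in> carrier G. h g \<otimes>\<^bsub>H\<^esub> y = y \<otimes>\<^bsub>H\<^esub> h g} G"
proof -
  define \<phi> where "\<phi> = (\<lambda>g. \<lambda>x \<in> carrier H. g \<otimes>\<^bsub>H\<^esub> x \<otimes>\<^bsub>H\<^esub> inv\<^bsub>H\<^esub> g)"
  interpret C: group_action H "carrier H" \<phi>
    unfolding \<phi>_def by (rule H.action_by_conjugation)
  interpret A: group_action G "carrier H" "\<phi> \<circ> h"
  proof -
    have "\<phi> \<in> hom H (BijGroup (carrier H))" "group (BijGroup (carrier H))"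
      using C.group_hom by (auto simp: group_hom_def group_hom_axioms_def)
    then show "group_action G (carrier H) (\<phi> \<circ> h)"
      using Group.hom_compose[OF homh, of \<phi>]
      by (auto simp: group_action_def group_hom_def group_hom_axioms_def)
  qed
  have orb: "orbit G (\<phi> \<circ> h) y = conj_class H y"
  proof -
    have "orbit G (\<phi> \<circ> h) y = (\<lambda>k. k \<otimes>\<^bsub>H\<^esub> y \<otimes>\<^bsub>H\<^esub> inv\<^bsub>H\<^esub> k) ` h ` carrier G"
      using assms(2) unfolding orbit_def \<phi>_def by auto
    then show ?thesis
      unfolding assms(1) conj_class_def by blast
  qed
  have "h g \<otimes>\<^bsub>H\<^esub> y \<otimes>\<^bsub>H\<^esub> inv\<^bsub>H\<^esub> h g = y \<longleftrightarrow> h g \<otimes>\<^bsub>H\<^esub> y = y \<otimes>\<^bsub>H\<^esub> h g" if "g \<in> carrier G" for g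
    using that assms(2) H.inv_solve_right'[of y "h g \<otimes>\<^bsub>H\<^esub> y" "h g"] by auto
  then have "stabilizer G (\<phi> \<circ> h) y = {g \<in> carrier G. h g \<otimes>\<^bsub>H\<^esub> y = y \<otimes>\<^bsub>H\<^esub> h g}"
    using assms unfolding stabilizer_def \<phi>_def by auto
  then show "card (conj_class H y) * card {g \<in> carrier G. h g \<otimes>\<^bsub>H\<^esub> y = y \<otimes>\<^bsub>H\<^esub> h g} = order G"
    and "subgroup {g \<in> carrier G. h g \<otimes>\<^bsub>H\<^esub> y = y \<otimes>\<^bsub>H\<^esub> h g} G"
    using A.orbit_stabilizer_theorem[OF assms(2)] A.stabilizer_subgroup[OF assms(2)] orb by simp_all
qed

text \<open>Every fibre of \<open>h\<close> is a coset of the kernel.\<close>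

lemma (in group_hom) card_vimage:
  assumes "finite (carrier G)" "h ` carrier G = carrier H" "T \<subseteq> carrier H"
  shows "card {x \<in> carrier G. h x \<in> T} = card (kernel G H h) * card T"
proof -
  have fib: "card {x \<in> carrier G. h x = y} = card (kernel G H h)" if y: "y \<in> carrier H" for y
  proof -
    obtain z where z: "z \<in> carrier G" "y = h z" using y assms(2)[symmetric] by blast
    have sub: "kernel G H h \<subseteq> carrier G" by (rule subgroup.subset[OF subgroup_kernel])
    have "x \<in> kernel G H h #> z \<longleftrightarrow> h x = y" if x: "x \<in> carrier G" for x
    proof -
      have "x \<in> kernel G H h #> z \<longleftrightarrow> x \<otimes> inv z \<in> kernel G H h"
        by (rule subgroup.rcos_module[OF subgroup_kernel G.is_group z(1) x])
      also have "\<dots> \<longleftrightarrow> h x \<otimes>\<^bsub>H\<^esub> inv\<^bsub>H\<^esub> h z = \<one>\<^bsub>H\<^esub>"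
        using x z(1) by (simp add: kernel_def)
      also have "\<dots> \<longleftrightarrow> h x = y"
        using H.inv_solve_right'[of "\<one>\<^bsub>H\<^esub>" "h x" "h z"] x z by simp
      finally show ?thesis .
    qed
    then have "{x \<in> carrier G. h x = y} = kernel G H h #> z"
      using G.r_coset_subset_G[OF sub z(1)] by blast
    moreover have "card (kernel G H h #> z) = card (kernel G H h)"
      using G.card_rcosets_equal[OF G.rcosetsI[OF sub z(1)] sub] by (rule sym)
    ultimately show ?thesis by (rule subst[where P = "\<lambda>A. card A = card (kernel G H h)", OF sym])
  qed
  have "finite (carrier H)"
    using assms(1) by (subst assms(2)[symmetric]) simp
  then have "finite T"
    by (rule rev_finite_subset) fact
  have "card {x \<in> carrier G. h x \<in> T} = card (\<Union>y\<in>T. {x \<in> carrier G. h x = y})"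
    by (rule arg_cong[of _ _ card]) blast
  also have "\<dots> = (\<Sum>y\<in>T. card {x \<in> carrier G. h x = y})"
    using assms(1) \<open>finite T\<close> by (intro card_UN_disjoint) auto
  also have "\<dots> = (\<Sum>y\<in>T. card (kernel G H h))"
    by (rule sum.cong[OF refl], rule fib) (use assms(3) in blast)
  also have "\<dots> = card (kernel G H h) * card T"
    by simp
  finally show ?thesis .
qed

text \<open>Two orbit-stabiliser equations reduce the claim to the index of the centraliser
  \<open>C\<close> of \<open>x\<close> in the preimage \<open>D\<close> of the centraliser of
  \<open>h x\<close>. By \<open>prime_power_index\<close> it suffices that elements of
  \<open>D\<close> of order prime to \<open>q\<close> lie in \<open>C\<close>.\<close>

lemma (in group_hom) card_conj_class_eq_prime_power_mult:
  assumes fin: "finite (carrier G)" and surj: "h ` carrier G = carrier H"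
    and q: "Factorial_Ring.prime (q::nat)"
    and ker: "\<And>n. n \<in> kernel G H h \<Longrightarrow> \<exists>j. n [^] (q ^ j) = \<one>"
    and central: "\<And>g n m. g \<in> carrier G \<Longrightarrow> g [^] (m::nat) = \<one> \<Longrightarrow> coprime m q \<Longrightarrow>
      n \<in> kernel G H h \<Longrightarrow> g \<otimes> n = n \<otimes> g"
    and x: "x \<in> carrier G"
  obtains k where "card (conj_class G x) = q ^ k * card (conj_class H (h x))"
proof -
  define D where "D = {g \<in> carrier G. h g \<otimes>\<^bsub>H\<^esub> h x = h x \<otimes>\<^bsub>H\<^esub> h g}"
  define C where "C = {g \<in> carrier G. g \<otimes> x = x \<otimes> g}"
  have D: "card (conj_class H (h x)) * card D = order G" "subgroup D G"
    unfolding D_def using conj_orbit_stabilizer[OF surj, of "h x"] x by auto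
  have "group_hom G G (\<lambda>g. g)"
    by unfold_locales (auto simp: hom_def)
  then have C: "card (conj_class G x) * card C = order G" "subgroup C G"
    unfolding C_def using group_hom.conj_orbit_stabilizer[of G G "\<lambda>g. g" x] x by simp_all
  have "h g \<otimes>\<^bsub>H\<^esub> h x = h x \<otimes>\<^bsub>H\<^esub> h g" if "g \<in> C" for g
    using that x unfolding C_def by (metis (mono_tags, lifting) hom_mult mem_Collect_eq)
  then have "C \<subseteq> D"
    by (auto simp: C_def D_def)
  interpret GD: group "G\<lparr>carrier := D\<rparr>" by (rule G.subgroup_imp_group[OF D(2)])
  have C_mem: "g \<in> C" if g: "g \<in> D" "g [^] (m::nat) = \<one>" "coprime m q" for g m
  proof -
    define n where "n = g \<otimes> x \<otimes> inv g \<otimes> inv x"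
    have gc: "g \<in> carrier G" "h g \<otimes>\<^bsub>H\<^esub> h x = h x \<otimes>\<^bsub>H\<^esub> h g" using g by (auto simp: D_def)
    have n: "n \<in> carrier G" "g \<otimes> x = n \<otimes> x \<otimes> g"
      using gc x by (simp_all add: n_def G.m_assoc)
    \<comment> \<open>As \<open>h g\<close> and \<open>h x\<close> commute, the commutator
      \<open>n\<close> of \<open>g\<close> and \<open>x\<close> must die under \<open>h\<close>;
      cancelling the common factor will show this.\<close>
    have "h n \<otimes>\<^bsub>H\<^esub> (h x \<otimes>\<^bsub>H\<^esub> h g) = h x \<otimes>\<^bsub>H\<^esub> h g"
    proof -
      have "h (n \<otimes> x \<otimes> g) = h (g \<otimes> x)" using n by simp
      then show ?thesis using n(1) gc x by (simp add: H.m_assoc)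
    qed
    then have "n \<in> kernel G H h"
      using n gc x by (simp add: kernel_def)
    moreover obtain j where "n [^] (q ^ j) = \<one>" using ker calculation by blast
    moreover have "coprime m (q ^ j)" using g(3) by simp
    ultimately have "g \<otimes> x = x \<otimes> g"
      using G.twisted_pow_left_coprime[of g x n m "q ^ j"] n gc x central[of g m n] g by blast
    then show ?thesis using gc by (simp add: C_def)
  qed
  have "finite D" using fin by (simp add: D_def)
  then obtain k where "order (G\<lparr>carrier := D\<rparr>) = q ^ k * card C"
    using GD.prime_power_index[OF _ G.subgroup_incl[OF C(2) D(2) \<open>C \<subseteq> D\<close>] q] C_mem
    by (auto simp: G.nat_pow_consistent[symmetric])
  then have "card D = q ^ k * card C" by (simp add: order_def)
  moreover have "card C > 0"
    using C(1) fin G.order_gt_0_iff_finite by (metis mult_0_right neq0_conv)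
  moreover have "card (conj_class G x) * card C = (q ^ k * card (conj_class H (h x))) * card C"
    using C(1) D(1) calculation(1) by (simp add: mult_ac)
  ultimately show thesis using that[of k] by simp
qed

section \<open>Conjugacy classes and \<open>\<pi>\<close>-elements\<close>

lemma (in group) conj_nat_pow:
  fixes n :: nat
  assumes "a \<in> carrier G" "x \<in> carrier G"
  shows "(a \<otimes> x \<otimes> inv a) [^] n = a \<otimes> x [^] n \<otimes> inv a"
proof (induction n)
  case 0
  then show ?case using assms by simp
next
  case (Suc n)
  have "(a \<otimes> x [^] n \<otimes> inv a) \<otimes> (a \<otimes> x \<otimes> inv a) = a \<otimes> (x [^] n \<otimes> x) \<otimes> inv a"
    using assms inv_solve_left[of "inv a"] by (simp add: m_assoc) (simp add: m_assoc[symmetric])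
  then show ?case using Suc by simp
qed

lemma (in group) ord_conj:
  assumes "a \<in> carrier G" "x \<in> carrier G"
  shows "ord (a \<otimes> x \<otimes> inv a) = ord x"
proof -
  have "(a \<otimes> x \<otimes> inv a) [^] n = \<one> \<longleftrightarrow> ord x dvd n" for n :: nat
  proof -
    have "a \<otimes> x [^] n \<otimes> inv a = \<one> \<longleftrightarrow> a \<otimes> x [^] n = a"
      using assms inv_solve_right'[of \<one> "a \<otimes> x [^] n" a] by simp
    also have "\<dots> \<longleftrightarrow> x [^] n = \<one>"
      using assms by simp
    finally show ?thesis using assms by (simp add: conj_nat_pow pow_eq_id)
  qed
  then show ?thesis using ord_unique assms by simp
qed

lemma (in group) conj_class_self:
  "g \<in> carrier G \<Longrightarrow> g \<in> conj_class G g"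
  unfolding conj_class_def by (rule CollectI, rule exI[of _ \<one>]) simp

lemma (in group) conj_class_eq:
  assumes "g \<in> carrier G" "x \<in> conj_class G g"
  shows "conj_class G x = conj_class G g"
proof -
  have sub: "conj_class G v \<subseteq> conj_class G u" if uv: "u \<in> carrier G" "v \<in> conj_class G u" for u v
  proof
    fix w assume "w \<in> conj_class G v"
    then obtain a b where ab: "a \<in> carrier G" "b \<in> carrier G"
      "v = a \<otimes> u \<otimes> inv a" "w = b \<otimes> v \<otimes> inv b"
      using uv(2) by (auto simp: conj_class_def)
    then have "w = (b \<otimes> a) \<otimes> u \<otimes> inv (b \<otimes> a)"
      using uv(1) by (simp add: m_assoc inv_mult_group)
    then show "w \<in> conj_class G u"
      using ab unfolding conj_class_def by blast
  qed
  obtain a where a: "a \<in> carrier G" "x = a \<otimes> g \<otimes> inv a"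
    using assms(2) by (auto simp: conj_class_def)
  have "inv a \<otimes> x \<otimes> inv (inv a) = g"
    using a assms(1) by (simp add: m_assoc) (simp add: m_assoc[symmetric])
  then have "g \<in> conj_class G x"
    using a(1) unfolding conj_class_def by (metis (mono_tags, lifting) CollectI inv_closed)
  then show ?thesis
    using sub[OF assms] sub[of x g] a assms(1) by blast
qed

lemma (in group) conj_class_disjoint:
  assumes "g \<in> carrier G" "h \<in> carrier G" "conj_class G g \<noteq> conj_class G h"
  shows "conj_class G g \<inter> conj_class G h = {}"
  using assms conj_class_eq by blast

text \<open>Order and class size are constant on a class, so both conditions can be tested on the
  element itself instead of on a representative.\<close>

lemma (in group) mem_S_q_iff:
  "x \<in> S_q G \<pi> q \<longleftrightarrow> pi_elem G \<pi> x \<and> (\<exists>k. card (conj_class G x) = q ^ k)"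
proof
  assume "x \<in> S_q G \<pi> q"
  then obtain g k where g: "pi_elem G \<pi> g" "card (conj_class G g) = q ^ k" "x \<in> conj_class G g"
    by (auto simp: S_q_def)
  then have gc: "g \<in> carrier G" by (simp add: pi_elem_def)
  obtain a where "a \<in> carrier G" "x = a \<otimes> g \<otimes> inv a"
    using g(3) by (auto simp: conj_class_def)
  then have "pi_elem G \<pi> x"
    using g(1) gc by (simp add: pi_elem_def ord_conj)
  then show "pi_elem G \<pi> x \<and> (\<exists>k. card (conj_class G x) = q ^ k)"
    using conj_class_eq[OF gc g(3)] g(2) by auto
next
  assume x: "pi_elem G \<pi> x \<and> (\<exists>k. card (conj_class G x) = q ^ k)"
  then have "x \<in> conj_class G x" by (simp add: pi_elem_def conj_class_self)
  then show "x \<in> S_q G \<pi> q" using x by (auto simp: S_q_def)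
qed

text \<open>The orders of \<open>x\<close> and \<open>h x\<close> differ only by a power of
  \<open>q\<close>, and \<open>q\<close> belongs to \<open>\<pi>\<close>.\<close>

lemma (in group_hom) pi_elem_hom_iff:
  assumes q: "Factorial_Ring.prime (q::nat)" "q \<in> \<pi>"
    and ker: "\<And>n. n \<in> kernel G H h \<Longrightarrow> \<exists>j. n [^] (q ^ j) = \<one>"
    and x: "x \<in> carrier G"
  shows "pi_elem H \<pi> (h x) \<longleftrightarrow> pi_elem G \<pi> x"
proof -
  have "h x [^]\<^bsub>H\<^esub> G.ord x = \<one>\<^bsub>H\<^esub>"
    using hom_nat_pow[OF x, of "G.ord x"] x by (metis G.pow_ord_eq_1 hom_one)
  then have down: "H.ord (h x) dvd G.ord x"
    using x by (simp add: H.pow_eq_id)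
  have "h (x [^] H.ord (h x)) = \<one>\<^bsub>H\<^esub>"
    using hom_nat_pow[OF x, of "H.ord (h x)"] x by (metis H.pow_ord_eq_1 hom_closed)
  then obtain j where "(x [^] H.ord (h x)) [^] (q ^ j) = \<one>"
    using ker[of "x [^] H.ord (h x)"] x by (auto simp: kernel_def)
  then have up: "G.ord x dvd H.ord (h x) * q ^ j"
    using x by (simp add: G.nat_pow_pow G.pow_eq_id)
  show ?thesis
  proof
    assume H: "pi_elem H \<pi> (h x)"
    have "p \<in> \<pi>" if p: "Factorial_Ring.prime p" "p dvd G.ord x" for p
    proof (cases "p = q")
      case False
      have "p dvd H.ord (h x) * q ^ j" using p(2) up by (rule dvd_trans)
      then have "p dvd H.ord (h x)"
        using p(1) q(1) False by (metis prime_dvd_mult_iff prime_dvd_power primes_dvd_imp_eq)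
      then show ?thesis using H p(1) by (simp add: pi_elem_def)
    qed (use q in simp)
    then show "pi_elem G \<pi> x" using x by (simp add: pi_elem_def)
  next
    assume "pi_elem G \<pi> x"
    then show "pi_elem H \<pi> (h x)"
      using x down by (auto simp: pi_elem_def intro: dvd_trans)
  qed
qed

section \<open>The centre and the size of \<open>S_q\<close> modulo \<open>q\<close>\<close>

lemma (in group) grp_center_normal: "grp_center G \<lhd> G"
  unfolding normal_inv_iff
proof (intro conjI ballI)
  show "subgroup (grp_center G) G"
  proof
    fix x y assume xy: "x \<in> grp_center G" "y \<in> grp_center G"
    then have c: "x \<in> carrier G" "y \<in> carrier G" by (auto simp: grp_center_def)
    have "(x \<otimes> y) \<otimes> z = z \<otimes> (x \<otimes> y)" if z: "z \<in> carrier G" for z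
    proof -
      have "x \<otimes> z = z \<otimes> x" "y \<otimes> z = z \<otimes> y"
        using xy z unfolding grp_center_def by blast+
      then show ?thesis using z c by (metis m_assoc)
    qed
    then show "x \<otimes> y \<in> grp_center G" using c by (simp add: grp_center_def)
  next
    fix x assume x: "x \<in> grp_center G"
    then have c: "x \<in> carrier G" by (simp add: grp_center_def)
    have "inv x \<otimes> z = z \<otimes> inv x" if z: "z \<in> carrier G" for z
    proof -
      have "x \<otimes> inv z = inv z \<otimes> x"
        using x inv_closed[OF z] unfolding grp_center_def by blast
      then show ?thesis using c z by (metis inv_closed inv_inv inv_mult_group)
    qed
    then show "inv x \<in> grp_center G" using c by (simp add: grp_center_def)
  qed (auto simp: grp_center_def)
next
  fix x z assume x: "x \<in> carrier G" and "z \<in> grp_center G"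
  then have z: "z \<in> carrier G" "z \<otimes> x = x \<otimes> z"
    unfolding grp_center_def by blast+
  then have "x \<otimes> z \<otimes> inv x = z"
    using x inv_solve_right'[of z "x \<otimes> z" x] by simp
  then show "x \<otimes> z \<otimes> inv x \<in> grp_center G"
    using \<open>z \<in> grp_center G\<close> by simp
qed

lemma (in group) conj_class_singleton_imp_central:
  assumes "g \<in> carrier G" "card (conj_class G g) = 1"
  shows "g \<in> grp_center G"
proof -
  have eq: "conj_class G g = {g}"
    using assms conj_class_self by (metis card_1_singletonE singletonD)
  have "g \<otimes> y = y \<otimes> g" if y: "y \<in> carrier G" for y
  proof -
    have "y \<otimes> g \<otimes> inv y = g"
      using eq y unfolding conj_class_def by blast
    then show ?thesis
      using y assms(1) inv_solve_right'[of g "y \<otimes> g" y] by simp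
  qed
  then show ?thesis using assms(1) by (simp add: grp_center_def)
qed

lemma (in group) central_conj_class:
  assumes "g \<in> grp_center G"
  shows "conj_class G g = {g}"
proof -
  have g: "g \<in> carrier G" "\<And>y. y \<in> carrier G \<Longrightarrow> y \<otimes> g = g \<otimes> y"
    using assms unfolding grp_center_def by auto
  have "y \<otimes> g \<otimes> inv y = g" if y: "y \<in> carrier G" for y
    using g(1) y g(2)[OF y] inv_solve_right'[of g "y \<otimes> g" y] by simp
  then show ?thesis
    using conj_class_self[OF g(1)] by (auto simp: conj_class_def)
qed

text \<open>For commuting elements the order of a product divides the product of the orders, so no
  new primes appear. By Lagrange the number of central \<open>\<pi>\<close>-elements then divides
  the order of the centre.\<close>

lemma (in group) central_pi_elems_subgroup:
  "subgroup {z \<in> grp_center G. pi_elem G \<pi> z} G"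
proof -
  interpret Z: normal "grp_center G" G by (rule grp_center_normal)
  show ?thesis
  proof
    fix x y assume "x \<in> {z \<in> grp_center G. pi_elem G \<pi> z}" "y \<in> {z \<in> grp_center G. pi_elem G \<pi> z}"
    then have xy: "x \<in> grp_center G" "y \<in> grp_center G" "pi_elem G \<pi> x" "pi_elem G \<pi> y"
      "x \<in> carrier G" "y \<in> carrier G" by auto
    then have "ord (x \<otimes> y) dvd ord x * ord y"
      using ord_mul_divides[of x y] unfolding grp_center_def by blast
    then have "pi_elem G \<pi> (x \<otimes> y)"
      using xy unfolding pi_elem_def by (meson dvd_trans m_closed prime_dvd_multD)
    then show "x \<otimes> y \<in> {z \<in> grp_center G. pi_elem G \<pi> z}"
      using xy by simp
  qed (auto simp: pi_elem_def)
qed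

text \<open>The central part \<open>Z\<close> of \<open>S_q\<close> is a subgroup of the centre, so
  \<open>q\<close> does not divide its order. The rest, \<open>R\<close>, is a disjoint union of
  noncentral classes, each of size divisible by \<open>q\<close>.\<close>

lemma (in group) not_dvd_card_S_q:
  assumes fin: "finite (carrier G)" and q: "Factorial_Ring.prime q"
    and center: "\<not> q dvd card (grp_center G)"
  shows "\<not> q dvd card (S_q G \<pi> q)"
proof -
  define Z where "Z = {z \<in> grp_center G. pi_elem G \<pi> z}"
  define R where "R = S_q G \<pi> q - grp_center G"
  have S_car: "S_q G \<pi> q \<subseteq> carrier G" by (auto simp: mem_S_q_iff pi_elem_def)
  have inter: "S_q G \<pi> q \<inter> grp_center G = Z"
  proof -
    \<comment> \<open>Exponent 0 counts as a power of \<open>q\<close>, which puts every central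
      \<open>\<pi>\<close>-element into \<open>S_q\<close>.\<close>
    have "\<exists>k. card (conj_class G z) = q ^ k" if "z \<in> grp_center G" for z
      using central_conj_class[OF that] by (intro exI[of _ 0]) simp
    then show ?thesis unfolding Z_def by (auto simp: mem_S_q_iff)
  qed
  have split: "card (S_q G \<pi> q) = card Z + card R"
    unfolding R_def inter[symmetric]
    by (rule card_Int_Diff) (rule finite_subset[OF S_car fin])
  have "card Z dvd card (grp_center G)"
    using card_subgroup_dvd[OF central_pi_elems_subgroup normal_imp_subgroup[OF grp_center_normal], of \<pi>]
    by (auto simp: Z_def)
  then have "\<not> q dvd card Z" using center dvd_trans by blast
  have closed: "conj_class G x \<subseteq> R" if x: "x \<in> R" for x
  proof
    fix y assume y: "y \<in> conj_class G x"
    have xc: "x \<in> carrier G" using x S_car by (auto simp: R_def)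
    have eq: "conj_class G y = conj_class G x" by (rule conj_class_eq[OF xc y])
    have "y \<in> S_q G \<pi> q"
    proof -
      obtain a where "a \<in> carrier G" "y = a \<otimes> x \<otimes> inv a"
        using y by (auto simp: conj_class_def)
      then show ?thesis
        using x eq xc by (auto simp: R_def mem_S_q_iff pi_elem_def ord_conj)
    qed
    moreover have "y \<notin> grp_center G"
    proof
      assume "y \<in> grp_center G"
      then have "conj_class G x = {y}" using central_conj_class eq by simp
      then show False
        using conj_class_self[OF xc] \<open>y \<in> grp_center G\<close> x by (auto simp: R_def)
    qed
    ultimately show "y \<in> R" by (simp add: R_def)
  qed
  have "q dvd card (\<Union> (conj_class G ` R))"
  proof (rule dvd_partition)
    show "finite (\<Union> (conj_class G ` R))"
      using closed S_car by (intro finite_subset[OF _ fin]) (auto simp: R_def)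
    show "\<forall>c\<in>conj_class G ` R. q dvd card c"
    proof
      fix c assume "c \<in> conj_class G ` R"
      then obtain x where x: "x \<in> R" "c = conj_class G x" by blast
      then obtain k where k: "card c = q ^ k" by (auto simp: R_def mem_S_q_iff)
      \<comment> \<open>Exponent 0 would mean a singleton class, hence a central element, and these
        are excluded from \<open>R\<close>.\<close>
      have "k \<noteq> 0"
        using k x S_car conj_class_singleton_imp_central[of x]
        by (cases "k = 0") (auto simp: R_def subset_iff)
      then show "q dvd card c" using k by (simp add: dvd_power)
    qed
    show "\<forall>c1\<in>conj_class G ` R. \<forall>c2\<in>conj_class G ` R. c1 \<noteq> c2 \<longrightarrow> c1 \<inter> c2 = {}"
      using conj_class_disjoint S_car by (auto simp: R_def)
  qed
  moreover have "\<Union> (conj_class G ` R) = R"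
  proof
    show "\<Union> (conj_class G ` R) \<subseteq> R" using closed by blast
    have "x \<in> conj_class G x" if "x \<in> R" for x
      using that S_car by (intro conj_class_self) (auto simp: R_def)
    then show "R \<subseteq> \<Union> (conj_class G ` R)" by blast
  qed
  ultimately have "q dvd card R" by simp
  then show ?thesis
    using \<open>\<not> q dvd card Z\<close> split by (simp add: dvd_add_left_iff)
qed

section \<open>The upper central series in terms of commutators\<close>

lemma (in group_hom) normal_vimage:
  assumes "M \<lhd> H"
  shows "{x \<in> carrier G. h x \<in> M} \<lhd> G"
proof -
  interpret M: normal M H by fact
  have "subgroup {x \<in> carrier G. h x \<in> M} G"
    by (intro G.subgroupI) auto
  then show ?thesis
    using M.inv_op_closed2 by (auto simp: G.normal_inv_iff)
qed

lemma (in normal) rcos_group_hom: "group_hom G (G Mod H) (\<lambda>x. H #> x)"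
  using is_group factorgroup_is_group r_coset_hom_Mod
  by (simp add: group_hom_def group_hom_axioms_def)

lemma (in normal) rcos_eq_self_iff:
  assumes "x \<in> carrier G"
  shows "H #> x = H \<longleftrightarrow> x \<in> H"
  using rcos_self[OF assms subgroup_axioms] coset_join2[OF assms subgroup_axioms] by auto

lemma (in normal) rcos_commute_iff:
  assumes "x \<in> carrier G" "y \<in> carrier G"
  shows "(H #> x) \<otimes>\<^bsub>G Mod H\<^esub> (H #> y) = (H #> y) \<otimes>\<^bsub>G Mod H\<^esub> (H #> x)
    \<longleftrightarrow> x \<otimes> y \<otimes> inv x \<otimes> inv y \<in> H"
proof -
  have "(H #> x) \<otimes>\<^bsub>G Mod H\<^esub> (H #> y) = (H #> y) \<otimes>\<^bsub>G Mod H\<^esub> (H #> x)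
    \<longleftrightarrow> H #> (x \<otimes> y) = H #> (y \<otimes> x)"
    using assms by (simp add: rcos_sum)
  also have "\<dots> \<longleftrightarrow> x \<otimes> y \<in> H #> (y \<otimes> x)"
    using assms repr_independence[OF _ _ subgroup_axioms, of "x \<otimes> y" "y \<otimes> x"]
      rcos_self[OF _ subgroup_axioms, of "x \<otimes> y"] by auto
  also have "\<dots> \<longleftrightarrow> x \<otimes> y \<otimes> inv (y \<otimes> x) \<in> H"
    using assms by (intro rcos_module is_group) auto
  finally show ?thesis
    using assms by (simp add: inv_mult_group m_assoc)
qed

lemma (in normal) rcos_central_iff:
  assumes "x \<in> carrier G"
  shows "H #> x \<in> grp_center (G Mod H) \<longleftrightarrow> (\<forall>y \<in> carrier G. x \<otimes> y \<otimes> inv x \<otimes> inv y \<in> H)"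
  using assms rcos_commute_iff[OF assms]
  by (auto simp: grp_center_def carrier_FactGroup simp del: mult_FactGroup)

text \<open>Each term after the first is the preimage of the centre of a quotient. Normality of the
  preceding term is what makes that quotient a group, so it drives the induction.\<close>

lemma (in group) upper_central_normal: "upper_central G i \<lhd> G"
proof (induction i)
  case 0
  then show ?case by (simp add: one_is_normal)
next
  case (Suc i)
  interpret N: normal "upper_central G i" G by fact
  interpret f: group_hom G "G Mod upper_central G i" "\<lambda>x. upper_central G i #> x"
    by (rule N.rcos_group_hom)
  show ?case
    using f.normal_vimage[OF f.H.grp_center_normal] by simp
qed

text \<open>Replaces centrality in a factor group by a condition on commutators in \<open>G\<close>,
  which makes different terms of the series comparable.\<close>

lemma (in group) mem_upper_central_Suc_iff:
  "x \<in> upper_central G (Suc i) \<longleftrightarrow>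
    x \<in> carrier G \<and> (\<forall>y \<in> carrier G. x \<otimes> y \<otimes> inv x \<otimes> inv y \<in> upper_central G i)"
  using normal.rcos_central_iff[OF upper_central_normal[of i]] by auto

lemma (in group) upper_central_mono:
  assumes "i \<le> j"
  shows "upper_central G i \<subseteq> upper_central G j"
proof (rule lift_Suc_mono_le[OF _ assms])
  fix n
  interpret N: normal "upper_central G n" G by (rule upper_central_normal)
  show "upper_central G n \<subseteq> upper_central G (Suc n)"
  proof
    fix x assume x: "x \<in> upper_central G n"
    have "x \<otimes> y \<otimes> inv x \<otimes> inv y \<in> upper_central G n" if y: "y \<in> carrier G" for y
    proof -
      \<comment> \<open>The commutator is \<open>x\<close> times a conjugate of
        \<open>inv x\<close>, and both lie in the normal subgroup.\<close>
      have "x \<otimes> (y \<otimes> inv x \<otimes> inv y) \<in> upper_central G n"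
        using x N.inv_op_closed2[OF y N.m_inv_closed[OF x]] by (rule N.m_closed)
      then show ?thesis using y N.mem_carrier[OF x] by (simp add: m_assoc)
    qed
    then show "x \<in> upper_central G (Suc n)"
      using N.mem_carrier[OF x] by (simp only: mem_upper_central_Suc_iff) blast
  qed
qed

text \<open>Choose for every hypercentral element an index \<open>f x\<close> of a term containing
  it; as the series increases, the largest of these finitely many indices works.\<close>

lemma (in group) hypercentre_eq_upper_central:
  assumes "finite (carrier G)"
  obtains m where "hypercentre G = upper_central G m"
proof -
  have sub: "upper_central G i \<subseteq> carrier G" for i
    by (rule subgroup.subset[OF normal_imp_subgroup[OF upper_central_normal]])
  then have fin: "finite (hypercentre G)"
    using assms by (auto simp: hypercentre_def intro: finite_subset)
  obtain f where f: "\<And>x. x \<in> hypercentre G \<Longrightarrow> x \<in> upper_central G (f x)"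
    unfolding hypercentre_def by (metis UN_E)
  define m where "m = Max (f ` hypercentre G)"
  have "f x \<le> m" if "x \<in> hypercentre G" for x
    unfolding m_def using that fin by simp
  then have "hypercentre G \<subseteq> upper_central G m"
    using f upper_central_mono by blast
  then have "hypercentre G = upper_central G m"
    by (auto simp: hypercentre_def)
  then show thesis by (rule that)
qed

lemma (in group) hypercentral_commute_coprime:
  fixes a b :: nat
  assumes x: "x \<in> upper_central G m" and h: "h \<in> carrier G"
    and "h [^] a = \<one>" "x [^] b = \<one>" "coprime a b"
  shows "h \<otimes> x = x \<otimes> h"
proof -
  interpret M: normal "upper_central G m" G by (rule upper_central_normal)
  have xc: "x \<in> carrier G" by (rule M.mem_carrier[OF x])
  define n where "n = h \<otimes> x \<otimes> inv h \<otimes> inv x"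
  have n: "n \<in> carrier G" "h \<otimes> x = n \<otimes> x \<otimes> h"
    using h xc by (simp_all add: n_def m_assoc)
  txt \<open>The commutator \<open>n\<close> descends the upper central series: once it is central modulo a term,
    both coprime powers of it are trivial modulo that term.\<close>
  have "n \<in> upper_central G 0"
  proof (rule inc_induct[of 0 m])
    show "n \<in> upper_central G m"
      unfolding n_def by (intro M.m_closed M.inv_op_closed2 M.m_inv_closed x h)
  next
    fix i assume n_mem: "n \<in> upper_central G (Suc i)"
    let ?N = "upper_central G i"
    interpret N: normal ?N G by (rule upper_central_normal)
    interpret f: group_hom G "G Mod ?N" "\<lambda>x. ?N #> x" by (rule N.rcos_group_hom)
    have "?N #> n \<in> grp_center (G Mod ?N)"
      using n_mem by simp
    moreover have "(?N #> h) \<otimes>\<^bsub>G Mod ?N\<^esub> (?N #> x) = (?N #> n) \<otimes>\<^bsub>G Mod ?N\<^esub> (?N #> x) \<otimes>\<^bsub>G Mod ?N\<^esub> (?N #> h)"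
      using n h xc f.hom_mult by (metis m_closed)
    moreover have "(?N #> h) [^]\<^bsub>G Mod ?N\<^esub> a = \<one>\<^bsub>G Mod ?N\<^esub>" "(?N #> x) [^]\<^bsub>G Mod ?N\<^esub> b = \<one>\<^bsub>G Mod ?N\<^esub>"
      using f.hom_nat_pow[OF h, of a] f.hom_nat_pow[OF xc, of b] assms(3,4) f.hom_one by metis+
    ultimately have "?N #> n = \<one>\<^bsub>G Mod ?N\<^esub>"
      using f.H.twisted_central_coprime[OF f.hom_closed[OF h] f.hom_closed[OF xc]] assms(5) by blast
    then show "n \<in> ?N"
      using N.rcos_eq_self_iff[OF n(1)] by simp
  qed simp
  then show ?thesis using n h xc by simp
qed

section \<open>The Sylow \<open>q\<close>-subgroup of the hypercentre\<close>

text \<open>The normaliser of \<open>N\<close> contains all elements of order prime to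
  \<open>q\<close>, so its index is a power of \<open>q\<close>; containing the Sylow subgroup
  \<open>N\<close>, it also has index prime to \<open>q\<close>. Hence it is all of
  \<open>G\<close>.\<close>

lemma (in group) normal_sylow_if_coprime_commute:
  assumes fin: "finite (carrier G)" and q: "Factorial_Ring.prime q"
    and N: "subgroup N G" "card N = ppart q (order G)"
    and comm: "\<And>g x m. g \<in> carrier G \<Longrightarrow> g [^] (m::nat) = \<one> \<Longrightarrow> coprime m q \<Longrightarrow> x \<in> N \<Longrightarrow> g \<otimes> x = x \<otimes> g"
  shows "N \<lhd> G"
proof -
  interpret N: subgroup N G by fact
  \<comment> \<open>The normaliser of \<open>N\<close>, with conjugation required in both directions
    so that closure under inverses is immediate.\<close>
  define M where "M = {g \<in> carrier G. \<forall>x\<in>N. g \<otimes> x \<otimes> inv g \<in> N \<and> inv g \<otimes> x \<otimes> g \<in> N}"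
  have M: "subgroup M G"
  proof (rule subgroupI)
    show "M \<noteq> {}" using N.mem_carrier by (auto simp: M_def intro!: exI[of _ \<one>])
    fix a b assume a: "a \<in> M" and b: "b \<in> M"
    have "(a \<otimes> b) \<otimes> x \<otimes> inv (a \<otimes> b) = a \<otimes> (b \<otimes> x \<otimes> inv b) \<otimes> inv a"
      "inv (a \<otimes> b) \<otimes> x \<otimes> (a \<otimes> b) = inv b \<otimes> (inv a \<otimes> x \<otimes> a) \<otimes> b" if "x \<in> N" for x
      using a b N.mem_carrier[OF that] by (simp_all add: M_def inv_mult_group m_assoc)
    then show "a \<otimes> b \<in> M" using a b by (auto simp: M_def)
  qed (auto simp: M_def)
  have "N \<subseteq> M"
    using N.mem_carrier by (auto simp: M_def)
  have "g \<in> M" if g: "g \<in> carrier G" "g [^] (m::nat) = \<one>" "coprime m q" for g m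
  proof -
    have "g \<otimes> x \<otimes> inv g = x \<and> inv g \<otimes> x \<otimes> g = x" if x: "x \<in> N" for x
    proof -
      have "g \<otimes> x = x \<otimes> g" by (rule comm[OF g x])
      moreover have "g \<otimes> x \<otimes> inv g = x" "inv g \<otimes> x \<otimes> g = x" if "g \<otimes> x = x \<otimes> g"
        using that g(1) N.mem_carrier[OF x] inv_solve_right'[of x "g \<otimes> x" g] inv_solve_left'[of x g "x \<otimes> g"]
        by (simp_all add: m_assoc)
      ultimately show ?thesis by blast
    qed
    then show ?thesis using g(1) by (auto simp: M_def)
  qed
  then obtain k where k: "order G = q ^ k * card M"
    using prime_power_index[OF fin M q] by blast
  obtain c where c: "card M = card N * c"
    using card_subgroup_dvd[OF N(1) M \<open>N \<subseteq> M\<close>] by (auto elim: dvdE)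
  have "order G \<noteq> 0" using fin by (simp add: order_gt_0_iff_finite)
  \<comment> \<open>\<open>N\<close> already carries the full \<open>q\<close>-part of the order of
    \<open>G\<close>, which leaves no room for a positive \<open>k\<close>.\<close>
  have "q ^ (k + multiplicity q (order G)) dvd order G"
    using k c N(2) by (metis dvd_triv_left mult.assoc power_add ppart_def)
  then have "k + multiplicity q (order G) \<le> multiplicity q (order G)"
    using \<open>order G \<noteq> 0\<close> q by (subst (asm) power_dvd_iff_le_multiplicity) auto
  then have "card M = card (carrier G)" using k by (simp add: order_def)
  then have "M = carrier G"
    using card_subset_eq[OF fin subgroup.subset[OF M]] by simp
  then show ?thesis
    using N(1) by (auto simp: normal_inv_iff M_def)
qed

text \<open>Normality is first obtained inside the hypercentre \<open>Z\<close>, where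
  \<open>N\<close> is a Sylow subgroup. There it forces \<open>N\<close> to contain every
  \<open>q\<close>-element of \<open>Z\<close>, and this description is invariant under conjugation
  by all of \<open>G\<close>.\<close>

lemma (in group) hypercentre_sylow:
  assumes fin: "finite (carrier G)" and q: "Factorial_Ring.prime q"
  obtains N where "N \<lhd> G" "card N = ppart q (card (hypercentre G))"
    "N = {x \<in> hypercentre G. \<exists>j. x [^] (q ^ j) = \<one>}"
proof -
  obtain m where m: "hypercentre G = upper_central G m"
    using hypercentre_eq_upper_central[OF fin] .
  define Z where "Z = hypercentre G"
  interpret Z: normal Z G unfolding Z_def m by (rule upper_central_normal)
  interpret GZ: group "G\<lparr>carrier := Z\<rparr>" by (rule subgroup_imp_group[OF Z.subgroup_axioms])
  have finZ: "finite Z" by (rule finite_subset[OF Z.subset fin])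
  have ordZ: "order (G\<lparr>carrier := Z\<rparr>) = card Z" by (simp add: order_def)
  have "card Z \<noteq> 0"
    using subgroup.finite_imp_card_positive[OF Z.subgroup_axioms fin] by simp
  then obtain c where c: "card Z = q ^ multiplicity q (card Z) * c" "\<not> q dvd c"
    using multiplicity_decompose'[of "card Z" q] q not_prime_unit[of q] by blast
  have cop: "coprime c (q ^ j)" for j
    using prime_imp_coprime[OF q c(2)] by (simp add: coprime_commute)
  obtain N where N: "subgroup N (G\<lparr>carrier := Z\<rparr>)" "card N = q ^ multiplicity q (card Z)"
    using sylow_thm[OF q GZ.is_group, of "multiplicity q (card Z)" c] c(1) ordZ finZ by auto
  have NZ: "N \<subseteq> Z" using subgroup.subset[OF N(1)] by simp
  have NG: "subgroup N G" by (rule incl_subgroup[OF Z.subgroup_axioms N(1)])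
  have N_pow: "x [^] (q ^ multiplicity q (card Z)) = \<one>" if "x \<in> N" for x
    using subgroup_pow_card[OF NG that] N(2) by simp
  have "N \<lhd> G\<lparr>carrier := Z\<rparr>"
  proof (rule GZ.normal_sylow_if_coprime_commute[OF _ q N(1)])
    show "finite (carrier (G\<lparr>carrier := Z\<rparr>))" using finZ by simp
    show "card N = ppart q (order (G\<lparr>carrier := Z\<rparr>))" using N(2) ordZ by (simp add: ppart_def)
    fix g x and k :: nat
    assume g: "g \<in> carrier (G\<lparr>carrier := Z\<rparr>)" "g [^]\<^bsub>G\<lparr>carrier := Z\<rparr>\<^esub> k = \<one>\<^bsub>G\<lparr>carrier := Z\<rparr>\<^esub>"
      and k: "coprime k q" and x: "x \<in> N"
    have "g \<otimes> x = x \<otimes> g"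
    proof (rule hypercentral_commute_coprime)
      show "x \<in> upper_central G m" using x NZ m by (auto simp: Z_def)
      show "g \<in> carrier G" using g(1) Z.subset by auto
      show "g [^] k = \<one>" using g(2) nat_pow_consistent[of g k Z] by simp
      show "x [^] (q ^ multiplicity q (card Z)) = \<one>" by (rule N_pow[OF x])
      show "coprime k (q ^ multiplicity q (card Z))" using k by simp
    qed
    then show "g \<otimes>\<^bsub>G\<lparr>carrier := Z\<rparr>\<^esub> x = x \<otimes>\<^bsub>G\<lparr>carrier := Z\<rparr>\<^esub> g" by simp
  qed
  \<comment> \<open>The index \<open>c\<close> of \<open>N\<close> in \<open>Z\<close> is prime to
    \<open>q\<close>, so a \<open>q\<close>-element has trivial image in the quotient of
    \<open>Z\<close> by \<open>N\<close>.\<close>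
  then have "x \<in> N" if "x \<in> Z" "x [^] (q ^ j) = \<one>" for x j
    using that GZ.coprime_quotient_mem[of N c x "q ^ j"] c(1) N(2) ordZ cop[of j]
      nat_pow_consistent[of x "q ^ j" Z] prime_gt_0_nat[OF q] by (simp add: mult.commute)
  then have N_eq: "N = {x \<in> Z. \<exists>j. x [^] (q ^ j) = \<one>}"
    using NZ N_pow by blast
  have "a \<otimes> x \<otimes> inv a \<in> N" if a: "a \<in> carrier G" and x: "x \<in> N" for a x
  proof -
    obtain j where j: "x \<in> Z" "x [^] (q ^ j) = \<one>" using x N_eq by blast
    have "(a \<otimes> x \<otimes> inv a) [^] (q ^ j) = \<one>"
      using conj_nat_pow[OF a Z.mem_carrier[OF j(1)]] j(2) a by simp
    then show ?thesis using N_eq Z.inv_op_closed2[OF a j(1)] by blast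
  qed
  then have "N \<lhd> G" using NG by (simp add: normal_inv_iff)
  then show thesis
    using that N(2) N_eq by (simp add: ppart_def Z_def)
qed

section \<open>Passage to the quotient by the hypercentral \<open>q\<close>-elements\<close>

theorem theorem3p1:
  fixes G (structure) and \<pi> :: "nat set" and q :: nat
  assumes "group G" and "finite (carrier G)"
    and "\<forall>p \<in> \<pi>. Factorial_Ring.prime p" and "q \<in> \<pi>"
  shows "ppart q (card (S_q G \<pi> q)) = ppart q (card (hypercentre G))
    \<and> (\<forall>P. sylow_subgroup G q P \<longrightarrow>
          (P \<subseteq> hypercentre G \<longleftrightarrow> ppart q (order G) = ppart q (card (S_q G \<pi> q))))"
proof -
  interpret group G by fact
  have q: "Factorial_Ring.prime q" using assms(3,4) by blast
  note fin = assms(2)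
  obtain m where m: "hypercentre G = upper_central G m"
    using hypercentre_eq_upper_central[OF fin] .
  obtain N where N: "N \<lhd> G" "card N = ppart q (card (hypercentre G))"
    "N = {x \<in> hypercentre G. \<exists>j. x [^] (q ^ j) = \<one>}"
    using hypercentre_sylow[OF fin q] .
  interpret N: normal N G by fact
  interpret f: group_hom G "G Mod N" "\<lambda>x. N #> x" by (rule N.rcos_group_hom)
  have surj: "(\<lambda>x. N #> x) ` carrier G = carrier (G Mod N)" by (simp add: carrier_FactGroup)
  have finK: "finite (carrier (G Mod N))" unfolding surj[symmetric] using fin by simp
  have ker_eq: "kernel G (G Mod N) (\<lambda>x. N #> x) = N"
    using N.rcos_eq_self_iff subgroup.mem_carrier[OF N.subgroup_axioms] unfolding kernel_def
    by (simp only: one_FactGroup) blast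
  have ker: "\<exists>j. n [^] (q ^ j) = \<one>" if "n \<in> kernel G (G Mod N) (\<lambda>x. N #> x)" for n
    using that N(3) unfolding ker_eq by blast
  have comm: "g \<otimes> n = n \<otimes> g" if g: "g \<in> carrier G" "g [^] (k::nat) = \<one>" "coprime k q"
    and n: "n \<in> kernel G (G Mod N) (\<lambda>x. N #> x)" for g n k
  proof -
    obtain j where "n [^] (q ^ j) = \<one>" using ker n by blast
    moreover have "n \<in> upper_central G m" using n N(3) m unfolding ker_eq by blast
    ultimately show ?thesis
      using hypercentral_commute_coprime[of n m g k "q ^ j"] g by simp
  qed
  \<comment> \<open>Neither condition is affected by passing to \<open>G Mod N\<close>: class sizes
    change by a power of \<open>q\<close>, and so do element orders.\<close>
  have S_iff: "x \<in> S_q G \<pi> q \<longleftrightarrow> N #> x \<in> S_q (G Mod N) \<pi> q" if x: "x \<in> carrier G" for x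
  proof -
    obtain k where k: "card (conj_class G x) = q ^ k * card (conj_class (G Mod N) (N #> x))"
      using f.card_conj_class_eq_prime_power_mult[OF fin surj q ker comm x] .
    have "(\<exists>i. card (conj_class G x) = q ^ i) \<longleftrightarrow> (\<exists>i. card (conj_class (G Mod N) (N #> x)) = q ^ i)"
    proof
      assume "\<exists>i. card (conj_class G x) = q ^ i"
      then obtain i where "card (conj_class (G Mod N) (N #> x)) dvd q ^ i" using k by (metis dvd_triv_right)
      then show "\<exists>i. card (conj_class (G Mod N) (N #> x)) = q ^ i"
        using divides_primepow_nat[OF q] by blast
    next
      assume "\<exists>i. card (conj_class (G Mod N) (N #> x)) = q ^ i"
      then show "\<exists>i. card (conj_class G x) = q ^ i" using k by (metis power_add)
    qed
    then show ?thesis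
      using f.pi_elem_hom_iff[OF q assms(4) ker x] by (simp add: mem_S_q_iff f.H.mem_S_q_iff)
  qed
  have "S_q G \<pi> q = {x \<in> carrier G. N #> x \<in> S_q (G Mod N) \<pi> q}"
  proof -
    have "x \<in> carrier G" if "x \<in> S_q G \<pi> q" for x
      using that by (simp add: mem_S_q_iff pi_elem_def)
    then show ?thesis using S_iff by blast
  qed
  moreover have "S_q (G Mod N) \<pi> q \<subseteq> carrier (G Mod N)"
    by (auto simp: f.H.mem_S_q_iff pi_elem_def)
  ultimately have card_S: "card (S_q G \<pi> q) = card N * card (S_q (G Mod N) \<pi> q)"
    using f.card_vimage[OF fin surj, of "S_q (G Mod N) \<pi> q"] ker_eq by simp
  \<comment> \<open>A central element of order \<open>q\<close> in \<open>G Mod N\<close> lifts to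
    some \<open>x\<close> that is central modulo \<open>N\<close>, hence hypercentral, and of
    \<open>q\<close>-power order. Such an \<open>x\<close> already lies in \<open>N\<close>.\<close>
  have "\<not> q dvd card (grp_center (G Mod N))"
  proof
    assume dvd: "q dvd card (grp_center (G Mod N))"
    obtain U where U: "U \<in> grp_center (G Mod N)" "U \<noteq> \<one>\<^bsub>G Mod N\<^esub>" "U [^]\<^bsub>G Mod N\<^esub> q = \<one>\<^bsub>G Mod N\<^esub>"
      using f.H.cauchy_subgroup[OF finK normal_imp_subgroup[OF f.H.grp_center_normal] q dvd] .
    then have "U \<in> carrier (G Mod N)" unfolding grp_center_def by blast
    then obtain x where x: "x \<in> carrier G" "U = N #> x" unfolding surj[symmetric] by blast
    have "N #> (x [^] q) = N"
      using f.hom_nat_pow[OF x(1), of q] U(3) x(2) by simp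
    then have "x [^] q \<in> N" using N.rcos_eq_self_iff x(1) by simp
    then obtain j where "(x [^] q) [^] (q ^ j) = \<one>" using N(3) by blast
    then have x_pow: "x [^] (q ^ Suc j) = \<one>" using x(1) by (simp add: nat_pow_pow)
    \<comment> \<open>All commutators of \<open>x\<close> lie in \<open>N\<close>, which is
      contained in the term with index \<open>m\<close>; so \<open>x\<close> lies in the next
      term.\<close>
    have "x \<otimes> y \<otimes> inv x \<otimes> inv y \<in> upper_central G m" if "y \<in> carrier G" for y
      using that U(1) N.rcos_central_iff[OF x(1)] x(2) N(3) m by blast
    then have "x \<in> upper_central G (Suc m)"
      using x(1) by (simp only: mem_upper_central_Suc_iff) blast
    then have "x \<in> hypercentre G" unfolding hypercentre_def by blast
    then have "x \<in> N" using N(3) x_pow by blast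
    then show False using U(2) x N.rcos_eq_self_iff by simp
  qed
  then have "\<not> q dvd card (S_q (G Mod N) \<pi> q)"
    by (rule f.H.not_dvd_card_S_q[OF finK q])
  then have main: "ppart q (card (S_q G \<pi> q)) = ppart q (card (hypercentre G))"
    using card_S N(2) q
    by (simp add: ppart_def mult.commute[of "_ ^ _"] multiplicity_prime_elem_times_other multiplicity_same_power')
  have "P \<subseteq> hypercentre G \<longleftrightarrow> ppart q (order G) = ppart q (card (hypercentre G))"
    if "sylow_subgroup G q P" for P
  proof -
    have P: "subgroup P G" "card P = ppart q (order G)"
      using that by (auto simp: sylow_subgroup_def)
    have hyp: "subgroup (hypercentre G) G"
      unfolding m by (rule normal_imp_subgroup[OF upper_central_normal])
    have pos: "card (hypercentre G) \<noteq> 0" "order G \<noteq> 0"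
      using fin subgroup.finite_imp_card_positive[OF hyp fin] by (auto simp: order_gt_0_iff_finite)
    show ?thesis
    proof
      assume "P \<subseteq> hypercentre G"
      then have "q ^ multiplicity q (order G) dvd card (hypercentre G)"
        using card_subgroup_dvd[OF P(1) hyp] P(2) by (simp add: ppart_def)
      then have "multiplicity q (order G) \<le> multiplicity q (card (hypercentre G))"
        using pos q by (subst (asm) power_dvd_iff_le_multiplicity) auto
      moreover have "multiplicity q (card (hypercentre G)) \<le> multiplicity q (order G)"
        using card_subgroup_dvd[OF hyp subgroup_self subgroup.subset[OF hyp]] pos(2)
        by (intro dvd_imp_multiplicity_le) (auto simp: order_def)
      ultimately show "ppart q (order G) = ppart q (card (hypercentre G))"
        by (simp add: ppart_def)
    next
      assume eq: "ppart q (order G) = ppart q (card (hypercentre G))"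
      obtain c where c: "order G = q ^ multiplicity q (order G) * c" "\<not> q dvd c"
        using multiplicity_decompose'[of "order G" q] pos q not_prime_unit[of q] by blast
      \<comment> \<open>Equal \<open>q\<close>-parts make \<open>N\<close> a Sylow subgroup of
        \<open>G\<close>. The quotient then has order \<open>c\<close> prime to \<open>q\<close>, so
        every element of \<open>P\<close> falls into \<open>N\<close>.\<close>
      have "card N = q ^ multiplicity q (order G)" using N(2) eq by (simp add: ppart_def)
      moreover have "coprime c (card P)"
        using prime_imp_coprime[OF q c(2)] P(2) by (simp add: ppart_def coprime_commute)
      ultimately have "x \<in> N" if "x \<in> P" for x
        using coprime_quotient_mem[OF N(1), of c x "card P"] c(1) prime_gt_0_nat[OF q]
          subgroup_pow_card[OF P(1) that] subgroup.mem_carrier[OF P(1) that] by (simp add: mult.commute)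
      then show "P \<subseteq> hypercentre G" using N(3) by blast
    qed
  qed
  then show ?thesis using main by auto
qed

end
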